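(* Let $\rho\approx 2.0585$ be the second largest root of the polynomial $4\rho^3-26\rho^2+39\rho-5$. For every finite capacity $c\in\mathbb{N}$ and every $\varepsilon>0$, there is no (deterministic) $(\rho-\varepsilon)$-competitive online algorithm for the open, non-preemptive online Dial-a-Ride problem on the line with a server of capacity $c$.
   Context: Open, non-preemptive online Dial-a-Ride on the line: an instance is a finite sequence $\sigma$ of requests $\sigma_i=(a_i,b_i;r_i)$ with $a_i,b_i\in\mathbb{R}$ and $r_i\ge 0$. Request $\sigma_i$ is revealed at its release time $r_i$; it must be picked up at position $a_i$ at some time $\ge r_i$ and transported to position $b_i$. A single server starts at the origin at time $0$, moves along the real line with speed at most $1$, and can carry at most $c$ requests simultaneously. Loading and unloading take no time. Non-preemptive: a loaded request may only be unloaded at its destination. Open: the server need not return to the origin. The objective is to minimize the completion time, i.e. the time at which all requests have been served. An online algorithm's decisions at time $t$ may depend only on the requests released up to time $t$ (in particular the number of requests is not known in advance). $\mathrm{Alg}(\sigma)$ denotes the completion time of algorithm $\mathrm{Alg}$ on $\sigma$, and $\mathrm{Opt}(\sigma)$ the minimum completion time of an offline solution that knows $\sigma$ in advance (but cannot pick up requests before their release times). $\mathrm{Alg}$ is $\alpha$-competitive if $\mathrm{Alg}(\sigma)\le\alpha\,\mathrm{Opt}(\sigma)$ for all $\sigma$. *)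

theory Defs
  imports "HOL-Analysis.Analysis" "HOL-Computational_Algebra.Polynomial"
begin

record request =
  src :: real
  dst :: real
  rel :: real

text \<open>A problem instance is a list of requests. The list need not be ordered by release time.\<close>

definition valid_instance :: "request list \<Rightarrow> bool" where
  "valid_instance \<sigma> \<longleftrightarrow> (\<forall>q \<in> set \<sigma>. 0 \<le> rel q)"

text \<open>
  A schedule is the trajectory of the server (only its values at times \<open>t \<ge> 0\<close> matter), and for
  each index \<open>i\<close> of a request the times at which this request is loaded and unloaded.
  A request is unloaded once, at its destination, so schedules are non-preemptive.
\<close>

record schedule =
  pos :: "real \<Rightarrow> real"
  pickup :: "nat \<Rightarrow> real"
  delivery :: "nat \<Rightarrow> real"

text \<open>
  Several actions may take place at one instant, one after another. The set
  \<open>carried n S t\<close> is the load after all actions at time \<open>t\<close>. A request with \<open>pickup = delivery = t\<close>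
  (only possible if source and destination agree) is in no such set, yet it occupies a place at
  the instant \<open>t\<close>. The best order of the actions at time \<open>t\<close> is to unload first, then to load and
  unload the instantaneous requests one at a time, and to load the others last. So an
  instantaneous request competes for a place only with the requests that are in the vehicle
  both before and after \<open>t\<close>, which is the second clause of \<open>respects_capacity\<close>.
\<close>

definition carried :: "nat \<Rightarrow> schedule \<Rightarrow> real \<Rightarrow> nat set" where
  "carried n S t = {i. i < n \<and> pickup S i \<le> t \<and> t < delivery S i}"

definition carried_through :: "nat \<Rightarrow> schedule \<Rightarrow> real \<Rightarrow> nat set" where
  "carried_through n S t = {i. i < n \<and> pickup S i < t \<and> t < delivery S i}"

definition respects_capacity :: "nat \<Rightarrow> nat \<Rightarrow> schedule \<Rightarrow> bool" where
  "respects_capacity c n S \<longleftrightarrow>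
     (\<forall>t. card (carried n S t) \<le> c) \<and>
     (\<forall>i<n. pickup S i = delivery S i \<longrightarrow> card (carried_through n S (pickup S i)) < c)"

definition feasible :: "nat \<Rightarrow> request list \<Rightarrow> schedule \<Rightarrow> bool" where
  "feasible c \<sigma> S \<longleftrightarrow>
     pos S 0 = 0 \<and> 1-lipschitz_on {0..} (pos S) \<and>
     (\<forall>i<length \<sigma>.
        rel (\<sigma> ! i) \<le> pickup S i \<and> pickup S i \<le> delivery S i \<and>
        pos S (pickup S i) = src (\<sigma> ! i) \<and> pos S (delivery S i) = dst (\<sigma> ! i)) \<and>
     respects_capacity c (length \<sigma>) S"

text \<open>The \<open>0\<close> is only relevant for the empty instance.\<close>

definition completion_time :: "request list \<Rightarrow> schedule \<Rightarrow> real" where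
  "completion_time \<sigma> S = Max (insert 0 (delivery S ` {..<length \<sigma>}))"

definition Opt :: "nat \<Rightarrow> request list \<Rightarrow> real" where
  "Opt c \<sigma> = Inf {completion_time \<sigma> S | S. feasible c \<sigma> S}"

text \<open>
  \<open>released \<sigma> t\<close> lists the indices in \<open>\<sigma>\<close> of the requests released up to time \<open>t\<close>. Two instances
  look the same at time \<open>t\<close> if the lists of the released requests themselves are equal; the indices
  may differ, since not yet released requests may stand between the released ones.
\<close>

definition released :: "request list \<Rightarrow> real \<Rightarrow> nat list" where
  "released \<sigma> t = filter (\<lambda>i. rel (\<sigma> ! i) \<le> t) [0..<length \<sigma>]"

definition same_up_to :: "real \<Rightarrow> request list \<Rightarrow> request list \<Rightarrow> bool" where
  "same_up_to t \<sigma> \<sigma>' \<longleftrightarrow> map ((!) \<sigma>) (released \<sigma> t) = map ((!) \<sigma>') (released \<sigma>' t)"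

text \<open>An action takes place at the same time \<open>\<le> t\<close> in both schedules, or in neither of them
  up to \<open>t\<close>.\<close>

definition time_agrees :: "real \<Rightarrow> real \<Rightarrow> real \<Rightarrow> bool" where
  "time_agrees t x y \<longleftrightarrow> x = y \<or> (t < x \<and> t < y)"

definition same_behaviour :: "real \<Rightarrow> request list \<Rightarrow> schedule \<Rightarrow> request list \<Rightarrow> schedule \<Rightarrow> bool" where
  "same_behaviour t \<sigma> S \<sigma>' S' \<longleftrightarrow>
     (\<forall>s\<in>{0..t}. pos S s = pos S' s) \<and>
     list_all2 (\<lambda>i j. time_agrees t (pickup S i) (pickup S' j) \<and>
                      time_agrees t (delivery S i) (delivery S' j))
       (released \<sigma> t) (released \<sigma>' t)"

text \<open>
  A deterministic online algorithm assigns to every instance the schedule that it ends up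
  performing. That its decisions at time \<open>t\<close> depend only on the requests released up to time \<open>t\<close>
  means that it behaves identically up to \<open>t\<close> on instances that look the same at time \<open>t\<close>.
\<close>

definition online_algorithm :: "nat \<Rightarrow> (request list \<Rightarrow> schedule) \<Rightarrow> bool" where
  "online_algorithm c Alg \<longleftrightarrow>
     (\<forall>\<sigma>. valid_instance \<sigma> \<longrightarrow> feasible c \<sigma> (Alg \<sigma>)) \<and>
     (\<forall>\<sigma> \<sigma>' t. valid_instance \<sigma> \<and> valid_instance \<sigma>' \<and> same_up_to t \<sigma> \<sigma>' \<longrightarrow>
        same_behaviour t \<sigma> (Alg \<sigma>) \<sigma>' (Alg \<sigma>'))"

definition competitive :: "nat \<Rightarrow> real \<Rightarrow> (request list \<Rightarrow> schedule) \<Rightarrow> bool" where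
  "competitive c \<alpha> Alg \<longleftrightarrow>
     (\<forall>\<sigma>. valid_instance \<sigma> \<longrightarrow> completion_time \<sigma> (Alg \<sigma>) \<le> \<alpha> * Opt c \<sigma>)"

definition rho_poly :: "real poly" where
  "rho_poly = [:-5, 39, -26, 4:]"

text \<open>The second largest root: exactly one root is larger.\<close>

definition rho :: real where
  "rho = (THE x. poly rho_poly x = 0 \<and> card {y. poly rho_poly y = 0 \<and> x < y} = 1)"

lemma rho_poly_roots:
  obtains x y z where "{x. poly rho_poly x = 0} = {x, y, z}"
    "0 < x" "x < 1" "2.05845 < y" "y < 2.0585" "4 < z" "z < 5"
proof -
  have ev: "poly rho_poly x = 4 * x^3 - 26 * x^2 + 39 * x - 5" for x
    by (simp add: rho_poly_def algebra_simps power2_eq_square power3_eq_cube)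
  obtain x where x: "0 < x" "x < 1" "poly rho_poly x = 0"
    using poly_IVT_pos[of 0 1 rho_poly] by (auto simp: ev)
  obtain y where y: "2.05845 < y" "y < 2.0585" "poly rho_poly y = 0"
    using poly_IVT_neg[of "2.05845" "2.0585" rho_poly]
    by (auto simp: ev power2_eq_square power3_eq_cube)
  obtain z where z: "4 < z" "z < 5" "poly rho_poly z = 0"
    using poly_IVT_pos[of 4 5 rho_poly] by (auto simp: ev)
  have nz: "rho_poly \<noteq> 0" by (simp add: rho_poly_def)
  have fin: "finite {x. poly rho_poly x = 0}" using nz by (rule poly_roots_finite)
  have le: "card {x. poly rho_poly x = 0} \<le> 3"
    using card_poly_roots_bound[OF nz] by (simp add: rho_poly_def)
  have c3: "card {x, y, z} = 3" using x y z by auto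
  have "{x, y, z} = {x. poly rho_poly x = 0}"
    by (rule card_seteq[OF fin]) (use x y z le c3 in auto)
  with x y z that show ?thesis by metis
qed

lemma rho_second_largest_root:
  "poly rho_poly rho = 0" "card {y. poly rho_poly y = 0 \<and> rho < y} = 1"
  and rho_bounds: "2.05845 < rho" "rho < 2.0585"
proof -
  obtain x y z where R: "{x. poly rho_poly x = 0} = {x, y, z}"
    and b: "0 < x" "x < 1" "2.05845 < y" "y < 2.0585" "4 < z" "z < 5"
    by (rule rho_poly_roots)
  have root: "poly rho_poly w = 0 \<longleftrightarrow> w = x \<or> w = y \<or> w = z" for w
    using R by blast
  have "{w. poly rho_poly w = 0 \<and> x < w} = {y, z}" using b by (auto simp: root)
  then have cx: "card {w. poly rho_poly w = 0 \<and> x < w} = 2" using b by auto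
  have "{w. poly rho_poly w = 0 \<and> y < w} = {z}" using b by (auto simp: root)
  then have cy: "card {w. poly rho_poly w = 0 \<and> y < w} = 1" by simp
  have "{w. poly rho_poly w = 0 \<and> z < w} = {}" using b by (auto simp: root)
  then have cz: "card {w. poly rho_poly w = 0 \<and> z < w} = 0" by (simp only: card.empty)
  have "rho = y"
    unfolding rho_def
  proof (rule the_equality)
    show "poly rho_poly y = 0 \<and> card {w. poly rho_poly w = 0 \<and> y < w} = 1"
      using cy root by blast
  next
    fix w assume w: "poly rho_poly w = 0 \<and> card {y. poly rho_poly y = 0 \<and> w < y} = 1"
    then consider "w = x" | "w = y" | "w = z" using root by blast
    then show "w = y" using w cx cz by cases simp_all
  qed
  then show "poly rho_poly rho = 0" "card {y. poly rho_poly y = 0 \<and> rho < y} = 1"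
    "2.05845 < rho" "rho < 2.0585"
    using root cy b by simp_all
qed

end

theory Submission
  imports Defs
begin

text \<open>
  Since \<open>rho < 103/50\<close>, it suffices to refute algorithms of ratio below \<open>103/50\<close>. All positions are
  multiplied by a sign \<open>s\<close>, chosen such that the server is not on the positive side at time \<open>1\<close>.

  At time \<open>1\<close> there appear \<open>c\<close> rides from \<open>1\<close> to \<open>3/2\<close>, and at a suitable time \<open>t \<in> {3/2, 13/8}\<close>,
  before any of them is loaded, a request at \<open>-t\<close>. Optimal tours can serve either side first. If
  the server turns to \<open>-t\<close> first, or delivers the rides late, it loses by the argument below.
  Otherwise all \<open>c\<close> rides are in the vehicle at some time; then a request at \<open>r\<close> appears at a time
  \<open>r\<close> at which they are still there. The full vehicle must visit \<open>3/2\<close> before \<open>-t\<close>, so that both orders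
  of serving \<open>r\<close> and \<open>-t\<close> are again late.

  The argument for a late server: it has served \<open>-w\<close> but not yet \<open>u > 0\<close>, while an optimal tour
  goes to \<open>u\<close>, turns and reaches \<open>-w\<close> at time \<open>2 * u + w\<close>. A new request at \<open>-w\<close> at that time forces
  the server to return there before it serves \<open>u\<close>. On its way from there to \<open>u\<close>, there is a time when a
  request at the current position of the optimal tour, which has gone further in the negative
  direction, makes both orders of serving it and \<open>u\<close> too expensive.
\<close>

section \<open>Point requests and tours that turn once\<close>

definition point :: "real \<Rightarrow> real \<Rightarrow> request" where
  "point x t = \<lparr>src = x, dst = x, rel = t\<rparr>"

lemma point_simps [simp]: "src (point x t) = x" "dst (point x t) = x" "rel (point x t) = t"
  by (simp_all add: point_def)

text \<open>The tour moves to \<open>s * u\<close>, where \<open>s\<close> is a sign, and from there forever in the direction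
  of \<open>- s\<close>.\<close>

definition sweep :: "nat \<Rightarrow> request list \<Rightarrow> real \<Rightarrow> real \<Rightarrow> real \<Rightarrow> bool" where
  "sweep c \<sigma> s u D \<longleftrightarrow>
     (\<exists>S. feasible c \<sigma> S \<and> pos S = (\<lambda>t. s * (u - \<bar>t - u\<bar>)) \<and> (\<forall>i<length \<sigma>. delivery S i \<le> D))"

text \<open>The new request is served at the instant \<open>d\<close>, by which all others are
  delivered, so no load changes.\<close>

lemma sweep_snoc:
  assumes "0 < c" "sweep c \<sigma> s u D" "D \<le> d" "rel q \<le> d"
    and q: "src q = s * (u - \<bar>d - u\<bar>)" "dst q = src q"
  shows "sweep c (\<sigma> @ [q]) s u d"
proof -
  let ?n = "length \<sigma>"
  obtain S where S: "feasible c \<sigma> S" "pos S = (\<lambda>t. s * (u - \<bar>t - u\<bar>))"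
    "\<forall>i<?n. delivery S i \<le> D"
    using assms by (auto simp: sweep_def)
  define S' where "S' = S\<lparr>pickup := (pickup S)(?n := d), delivery := (delivery S)(?n := d)\<rparr>"
  have "carried (Suc ?n) S' t = carried ?n S t" for t
    by (auto simp: carried_def S'_def less_Suc_eq)
  moreover have thr: "carried_through (Suc ?n) S' t = carried_through ?n S t" for t
    by (auto simp: carried_through_def S'_def less_Suc_eq)
  moreover have "carried_through ?n S d = {}"
    using S(3) \<open>D \<le> d\<close> by (force simp: carried_through_def)
  ultimately have "respects_capacity c (Suc ?n) S'"
    using S(1) \<open>0 < c\<close> by (auto simp: respects_capacity_def feasible_def less_Suc_eq S'_def)
  then have "feasible c (\<sigma> @ [q]) S'"
    using S(1,2) assms(4) q by (auto simp: feasible_def S'_def less_Suc_eq nth_append)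
  moreover have "\<forall>i<length (\<sigma> @ [q]). delivery S' i \<le> d"
    using S(3) \<open>D \<le> d\<close> by (force simp: S'_def less_Suc_eq)
  ultimately show ?thesis
    unfolding sweep_def using S(2) by (intro exI[of _ S']) (simp add: S'_def)
qed

lemma lipschitz_turn:
  fixes s u :: real
  assumes "\<bar>s\<bar> = 1"
  shows "1-lipschitz_on {0..} (\<lambda>t. s * (u - \<bar>t - u\<bar>))"
proof (rule lipschitz_onI)
  fix x y :: real
  have "dist (s * (u - \<bar>x - u\<bar>)) (s * (u - \<bar>y - u\<bar>)) = \<bar>s\<bar> * \<bar>\<bar>y - u\<bar> - \<bar>x - u\<bar>\<bar>"
    by (simp add: dist_real_def abs_mult[symmetric] algebra_simps)
  also have "\<dots> \<le> 1 * dist x y"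
    using abs_triangle_ineq3[of "y - u" "x - u"] by (simp add: assms dist_real_def abs_minus_commute)
  finally show "dist (s * (u - \<bar>x - u\<bar>)) (s * (u - \<bar>y - u\<bar>)) \<le> 1 * dist x y" .
qed simp

text \<open>All \<open>c\<close> rides are loaded at time \<open>x\<close> and unloaded at time
  \<open>y\<close>. The vehicle is full in between, so the serving times \<open>g j\<close> avoid
  that interval.\<close>

lemma sweep_rides:
  assumes "0 < c" "\<bar>s\<bar> = 1" "0 \<le> u" "x < y" "y \<le> D" "rel q \<le> x"
    and q: "src q = s * (u - \<bar>x - u\<bar>)" "dst q = s * (u - \<bar>y - u\<bar>)"
    and ps: "\<And>j. j < length ps \<Longrightarrow> rel (ps ! j) \<le> g j \<and> g j \<le> D \<and> (g j \<le> x \<or> y \<le> g j) \<and>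
      src (ps ! j) = s * (u - \<bar>g j - u\<bar>) \<and> dst (ps ! j) = s * (u - \<bar>g j - u\<bar>)"
  shows "sweep c (replicate c q @ ps) s u D"
proof -
  let ?\<sigma> = "replicate c q @ ps"
  define S where "S = \<lparr>pos = (\<lambda>t. s * (u - \<bar>t - u\<bar>)),
    pickup = (\<lambda>i. if i < c then x else g (i - c)), delivery = (\<lambda>i. if i < c then y else g (i - c))\<rparr>"
  have "card (carried (length ?\<sigma>) S t) \<le> c" for t
  proof -
    have "carried (length ?\<sigma>) S t \<subseteq> {..<c}" by (auto simp: carried_def S_def split: if_splits)
    from card_mono[OF _ this] show ?thesis by simp
  qed
  moreover have "carried_through (length ?\<sigma>) S (g j) = {}" if "j < length ps" for j
    using ps[OF that] by (auto simp: carried_through_def S_def split: if_splits)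
  ultimately have "respects_capacity c (length ?\<sigma>) S"
    using \<open>0 < c\<close> \<open>x < y\<close> by (auto simp: respects_capacity_def S_def split: if_splits)
  then have "feasible c ?\<sigma> S"
    using assms lipschitz_turn[of s u] by (auto simp: feasible_def S_def nth_append)
  moreover have "\<forall>i<length ?\<sigma>. delivery S i \<le> D"
    using ps \<open>y \<le> D\<close> by (auto simp: S_def)
  ultimately show ?thesis
    unfolding sweep_def by (intro exI[of _ S]) (simp add: S_def)
qed

section \<open>Algorithms of ratio below 103/50\<close>

text \<open>The bound refers to an arbitrary schedule instead of \<open>Opt\<close>, so that every
  explicit tour sets a deadline.\<close>

locale fast_algorithm =
  fixes c :: nat and Alg :: "request list \<Rightarrow> schedule"
  assumes c_pos: "0 < c"
    and online: "online_algorithm c Alg"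
    and fast: "\<lbrakk>valid_instance \<sigma>; feasible c \<sigma> S; completion_time \<sigma> S \<le> D; 0 < D; i < length \<sigma>\<rbrakk>
      \<Longrightarrow> delivery (Alg \<sigma>) i < 103/50 * D"
begin

abbreviation loc :: "request list \<Rightarrow> real \<Rightarrow> real" where
  "loc \<sigma> \<equiv> pos (Alg \<sigma>)"

abbreviation del :: "request list \<Rightarrow> nat \<Rightarrow> real" where
  "del \<sigma> \<equiv> delivery (Alg \<sigma>)"

lemma Alg_feasible: "valid_instance \<sigma> \<Longrightarrow> feasible c \<sigma> (Alg \<sigma>)"
  using online by (simp add: online_algorithm_def)

lemma speed:
  assumes "valid_instance \<sigma>" "0 \<le> x" "0 \<le> y"
  shows "\<bar>loc \<sigma> x - loc \<sigma> y\<bar> \<le> \<bar>x - y\<bar>"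
  using Alg_feasible[OF assms(1)] lipschitz_onD[of 1 "{0..}" "loc \<sigma>" x y] assms
  by (auto simp: feasible_def dist_real_def)

lemma signed_speed:
  assumes "valid_instance \<sigma>" "0 \<le> x" "x \<le> y" "\<bar>s\<bar> = 1"
  shows "s * loc \<sigma> x - s * loc \<sigma> y \<le> y - x" "s * loc \<sigma> y - s * loc \<sigma> x \<le> y - x"
proof -
  have "\<bar>loc \<sigma> x - loc \<sigma> y\<bar> \<le> y - x" using speed[of \<sigma> x y] assms by simp
  moreover have "s = 1 \<or> s = -1" using assms(4) by linarith
  ultimately show "s * loc \<sigma> x - s * loc \<sigma> y \<le> y - x" "s * loc \<sigma> y - s * loc \<sigma> x \<le> y - x" by auto
qed

lemma Alg_serves:
  assumes "valid_instance \<sigma>" "i < length \<sigma>"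
  shows "rel (\<sigma> ! i) \<le> pickup (Alg \<sigma>) i" "pickup (Alg \<sigma>) i \<le> del \<sigma> i" "0 \<le> rel (\<sigma> ! i)"
    "loc \<sigma> (pickup (Alg \<sigma>) i) = src (\<sigma> ! i)" "loc \<sigma> (del \<sigma> i) = dst (\<sigma> ! i)"
  using Alg_feasible[OF assms(1)] assms by (auto simp: feasible_def valid_instance_def)

lemma del_nonneg: "valid_instance \<sigma> \<Longrightarrow> i < length \<sigma> \<Longrightarrow> 0 \<le> del \<sigma> i"
  using Alg_serves[of \<sigma> i] by linarith

lemma deadline:
  assumes "valid_instance \<sigma>" "sweep c \<sigma> s u D" "0 < D" "i < length \<sigma>"
  shows "del \<sigma> i < 103/50 * D"
proof -
  obtain S where "feasible c \<sigma> S" "\<forall>i<length \<sigma>. delivery S i \<le> D"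
    using assms(2) by (auto simp: sweep_def)
  then show ?thesis
    using fast[of \<sigma> S D i] assms by (auto simp: completion_time_def)
qed

section \<open>Continuing an instance by later requests\<close>

lemma same_behaviour_append:
  assumes "valid_instance (\<sigma> @ qs)" "\<forall>q\<in>set qs. \<tau> \<le> rel q" "t < \<tau>"
  shows "\<forall>x\<in>{0..t}. loc \<sigma> x = loc (\<sigma> @ qs) x"
    and "\<lbrakk>i < length \<sigma>; rel (\<sigma> ! i) \<le> t\<rbrakk> \<Longrightarrow>
      time_agrees t (pickup (Alg \<sigma>) i) (pickup (Alg (\<sigma> @ qs)) i) \<and>
      time_agrees t (del \<sigma> i) (del (\<sigma> @ qs) i)"
proof -
  have rel: "released (\<sigma> @ qs) t = released \<sigma> t"
  proof -
    have "t < rel ((\<sigma> @ qs) ! i)" if "length \<sigma> \<le> i" "i < length \<sigma> + length qs" for i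
    proof -
      have "qs ! (i - length \<sigma>) \<in> set qs" using that by simp
      with assms(2,3) that show ?thesis by (fastforce simp: nth_append)
    qed
    then have "filter (\<lambda>i. rel ((\<sigma> @ qs) ! i) \<le> t) [length \<sigma>..<length \<sigma> + length qs] = []"
      by (auto simp: filter_empty_conv not_le)
    moreover have "filter (\<lambda>i. rel ((\<sigma> @ qs) ! i) \<le> t) [0..<length \<sigma>] =
        filter (\<lambda>i. rel (\<sigma> ! i) \<le> t) [0..<length \<sigma>]"
      by (rule filter_cong) (auto simp: nth_append)
    ultimately show ?thesis by (simp add: released_def upt_add_eq_append[of 0 "length \<sigma>" "length qs"])
  qed
  have "same_up_to t \<sigma> (\<sigma> @ qs)"
    unfolding same_up_to_def rel by (auto simp: released_def nth_append)
  moreover have "valid_instance \<sigma>" using assms(1) by (auto simp: valid_instance_def)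
  ultimately have "same_behaviour t \<sigma> (Alg \<sigma>) (\<sigma> @ qs) (Alg (\<sigma> @ qs))"
    using online assms(1) by (simp add: online_algorithm_def)
  then show "\<forall>x\<in>{0..t}. loc \<sigma> x = loc (\<sigma> @ qs) x"
    "\<lbrakk>i < length \<sigma>; rel (\<sigma> ! i) \<le> t\<rbrakk> \<Longrightarrow>
      time_agrees t (pickup (Alg \<sigma>) i) (pickup (Alg (\<sigma> @ qs)) i) \<and>
      time_agrees t (del \<sigma> i) (del (\<sigma> @ qs) i)"
    unfolding same_behaviour_def rel list_all2_same by (auto simp: released_def)
qed

text \<open>The online property yields agreement only before \<tau>, since the new requests may be
  visible at \<tau>. The value at \<tau> follows from the speed limit.\<close>

lemma loc_append:
  assumes v: "valid_instance (\<sigma> @ qs)" and q: "\<forall>q\<in>set qs. \<tau> \<le> rel q" and x: "0 \<le> x" "x \<le> \<tau>"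
  shows "loc (\<sigma> @ qs) x = loc \<sigma> x"
proof (cases "x < \<tau>")
  case True
  then show ?thesis using same_behaviour_append(1)[OF v q, of x] x by simp
next
  case False
  then have [simp]: "x = \<tau>" using x by simp
  have v': "valid_instance \<sigma>" using v by (auto simp: valid_instance_def)
  show ?thesis
  proof (rule ccontr)
    assume ne: "loc (\<sigma> @ qs) x \<noteq> loc \<sigma> x"
    have "\<tau> \<noteq> 0" using ne Alg_feasible[OF v] Alg_feasible[OF v'] by (auto simp: feasible_def)
    define e where "e = min \<tau> (\<bar>loc (\<sigma> @ qs) \<tau> - loc \<sigma> \<tau>\<bar> / 4)"
    have e: "0 < e" "e \<le> \<tau>" "4 * e \<le> \<bar>loc (\<sigma> @ qs) \<tau> - loc \<sigma> \<tau>\<bar>"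
      using ne \<open>\<tau> \<noteq> 0\<close> x by (auto simp: e_def min_def)
    then have "loc (\<sigma> @ qs) (\<tau> - e) = loc \<sigma> (\<tau> - e)"
      using same_behaviour_append(1)[OF v q, of "\<tau> - e"] by simp
    then show False
      using speed[OF v, of \<tau> "\<tau> - e"] speed[OF v', of \<tau> "\<tau> - e"] e by linarith
  qed
qed

text \<open>Actions at the instant \<tau> may already depend on the new requests, hence the strict
  inequalities.\<close>

lemma action_append:
  assumes v: "valid_instance (\<sigma> @ qs)" and q: "\<forall>q\<in>set qs. \<tau> \<le> rel q" and i: "i < length \<sigma>"
  shows "del \<sigma> i < \<tau> \<Longrightarrow> del (\<sigma> @ qs) i = del \<sigma> i"
    and "\<tau> \<le> del \<sigma> i \<Longrightarrow> \<tau> \<le> del (\<sigma> @ qs) i"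
    and "pickup (Alg \<sigma>) i < \<tau> \<Longrightarrow> pickup (Alg (\<sigma> @ qs)) i = pickup (Alg \<sigma>) i"
proof -
  have v': "valid_instance \<sigma>" using v by (auto simp: valid_instance_def)
  note A = Alg_serves[OF v' i]
  note B = Alg_serves[OF v, of i, simplified nth_append, simplified i]
  note agree = same_behaviour_append(2)[OF v q _ i]
  show "del (\<sigma> @ qs) i = del \<sigma> i" if "del \<sigma> i < \<tau>"
    using agree[OF that] A by (auto simp: time_agrees_def)
  show "pickup (Alg (\<sigma> @ qs)) i = pickup (Alg \<sigma>) i" if "pickup (Alg \<sigma>) i < \<tau>"
    using agree[OF that] A by (auto simp: time_agrees_def)
  show "\<tau> \<le> del (\<sigma> @ qs) i" if "\<tau> \<le> del \<sigma> i"
  proof (rule ccontr)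
    assume "\<not> \<tau> \<le> del (\<sigma> @ qs) i"
    then have less: "del (\<sigma> @ qs) i < \<tau>" by simp
    have "rel (\<sigma> ! i) \<le> del (\<sigma> @ qs) i" using B i by (simp add: trans_less_add1)
    from agree[OF less this] show False using that less by (auto simp: time_agrees_def)
  qed
qed

section \<open>Late servers and requests released on the tour\<close>

lemma loc_del:
  assumes "valid_instance \<sigma>" "i < length \<sigma>" "dst (\<sigma> ! i) = s * x" "\<bar>s\<bar> = 1"
  shows "s * loc \<sigma> (del \<sigma> i) = x"
proof -
  have "s * s = 1" using assms(4) abs_mult_self_eq[of s] by simp
  then show ?thesis using Alg_serves(5)[OF assms(1,2)] assms(3) by (simp add: mult.assoc[symmetric])
qed

text \<open>The tour is at the new request when it is released and serves it at once, so \<tau>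
  becomes the new bound on the optimum.\<close>

lemma release_on_sweep:
  assumes v: "valid_instance \<sigma>" and sw: "sweep c \<sigma> s u D" and s: "\<bar>s\<bar> = 1"
    and "0 < u" "u \<le> \<tau>" "D \<le> \<tau>"
  defines "\<sigma>' \<equiv> \<sigma> @ [point (s * (2 * u - \<tau>)) \<tau>]"
  shows "valid_instance \<sigma>'" "sweep c \<sigma>' s u \<tau>" "s * loc \<sigma>' \<tau> = s * loc \<sigma> \<tau>"
    "\<tau> \<le> del \<sigma>' (length \<sigma>)" "s * loc \<sigma>' (del \<sigma>' (length \<sigma>)) = 2 * u - \<tau>"
proof -
  show v': "valid_instance \<sigma>'" using v assms(4,5) by (auto simp: valid_instance_def \<sigma>'_def)
  show "sweep c \<sigma>' s u \<tau>"
    unfolding \<sigma>'_def using assms by (intro sweep_snoc[OF c_pos sw]) auto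
  show "s * loc \<sigma>' \<tau> = s * loc \<sigma> \<tau>"
    using loc_append[of \<sigma> "[point (s * (2 * u - \<tau>)) \<tau>]" \<tau> \<tau>] v' assms(4,5) by (simp add: \<sigma>'_def)
  show "\<tau> \<le> del \<sigma>' (length \<sigma>)"
    using Alg_serves(1,2)[OF v', of "length \<sigma>"] by (simp add: \<sigma>'_def)
  show "s * loc \<sigma>' (del \<sigma>' (length \<sigma>)) = 2 * u - \<tau>"
    using s by (intro loc_del[OF v']) (simp_all add: \<sigma>'_def)
qed

text \<open>The bounds on the position make both orders of serving the new request and the one at
  \<open>s * u\<close> too late.\<close>

lemma no_window:
  assumes v: "valid_instance \<sigma>" and sw: "sweep c \<sigma> s u D" and s: "\<bar>s\<bar> = 1"
    and u: "0 < u" and i: "i < length \<sigma>" "dst (\<sigma> ! i) = s * u"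
    and t: "D \<le> t" "u \<le> t" "t \<le> del \<sigma> i"
    and q: "s * loc \<sigma> t \<le> - (3/50 * t)" "3 * u - 47/50 * t \<le> s * loc \<sigma> t"
  shows False
proof -
  define \<sigma>' where "\<sigma>' = \<sigma> @ [point (s * (2 * u - t)) t]"
  let ?n = "length \<sigma>"
  note new = release_on_sweep[OF v sw s u t(2,1), folded \<sigma>'_def]
  have len: "i < length \<sigma>'" "?n < length \<sigma>'" and dst: "dst (\<sigma>' ! i) = s * u"
    using i by (auto simp: \<sigma>'_def nth_append)
  have ti: "t \<le> del \<sigma>' i"
    unfolding \<sigma>'_def by (rule action_append(2)) (use new(1) i t in \<open>auto simp: \<sigma>'_def\<close>)
  have ui: "s * loc \<sigma>' (del \<sigma>' i) = u" by (rule loc_del[OF new(1) len(1) dst s])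
  have late: "del \<sigma>' i < 103/50 * t" "del \<sigma>' ?n < 103/50 * t"
    using deadline[OF new(1,2)] len u t by auto
  \<comment> \<open>With \<open>p = s * loc \<sigma> t\<close>, serving \<open>s * u\<close> first
    takes at least until \<open>2 * t - p\<close>, the other order at least until
    \<open>3 * t + p - 3 * u\<close>.\<close>
  show False
  proof (cases "del \<sigma>' i \<le> del \<sigma>' ?n")
    case True
    show False
      using signed_speed(2)[OF new(1) _ ti s] signed_speed(1)[OF new(1) _ True s] new(3-5) ui late
        q u t ti by linarith
  next
    case False
    then have le: "del \<sigma>' ?n \<le> del \<sigma>' i" by simp
    show False
      using signed_speed(1)[OF new(1) _ new(4) s] signed_speed(2)[OF new(1) _ le s] new(3-5) ui late
        q u t ti by linarith
  qed
qed

lemma crossing: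
  assumes "valid_instance \<sigma>" "0 \<le> x" "x \<le> y"
    and "s * loc \<sigma> x \<le> a * x + d" "a * y + d \<le> s * loc \<sigma> y"
  obtains t where "x \<le> t" "t \<le> y" "s * loc \<sigma> t = a * t + d"
proof -
  have "1-lipschitz_on {0..} (loc \<sigma>)"
    using Alg_feasible[OF assms(1)] by (simp add: feasible_def)
  then have "continuous_on {x..y} (loc \<sigma>)"
    using lipschitz_on_continuous_on continuous_on_subset assms(2) by (metis atLeastatMost_subset_iff
        atLeast_iff subset_iff order_trans atLeastAtMost_iff)
  then have "continuous_on {x..y} (\<lambda>t. s * loc \<sigma> t - (a * t + d))"
    by (intro continuous_intros)
  from IVT'[OF _ _ assms(3) this, of 0] assms(4,5) that show thesis by auto
qed

text \<open>On its way to \<open>s * u\<close> the server attains the lower bound of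
  \<open>no_window\<close>, unless it already satisfies it at the turn. The turn is late and far
  enough for the upper bound to hold then, too.\<close>

lemma no_far_turn:
  assumes v: "valid_instance \<sigma>" and sw: "sweep c \<sigma> s u D" and s: "\<bar>s\<bar> = 1"
    and u: "0 < u" and i: "i < length \<sigma>" "dst (\<sigma> ! i) = s * u"
    and j: "j < length \<sigma>" "dst (\<sigma> ! j) = - s * w" "0 \<le> w"
    and t: "D \<le> del \<sigma> j" "u \<le> del \<sigma> j" "del \<sigma> j \<le> del \<sigma> i"
    and w: "3/50 * del \<sigma> j \<le> w" "159/44 * u \<le> del \<sigma> j + w"
  shows False
proof -
  let ?x = "del \<sigma> j" and ?y = "del \<sigma> i"
  have ui: "s * loc \<sigma> ?y = u" by (rule loc_del[OF v i s])
  have wj: "s * loc \<sigma> ?x = - w" by (rule loc_del[OF v j(1) _ s]) (simp add: j)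
  have x0: "0 \<le> ?x" using u t by simp
  have far: "u + w \<le> ?y - ?x" using signed_speed(2)[OF v x0 t(3) s] ui wj by simp
  show False
  proof (cases "3 * u - 47/50 * ?x \<le> - w")
    case True
    then show False using no_window[OF v sw s u i t] wj w by simp
  next
    case False
    then obtain z where z: "?x \<le> z" "z \<le> ?y" "s * loc \<sigma> z = -47/50 * z + 3 * u"
      using crossing[OF v x0 t(3), of s "-47/50" "3 * u"] ui wj far w u j(3) by auto
    \<comment> \<open>Hence \<open>97/50 * z \<ge> ?x + w + 3 * u\<close>. The constant 159/44 turns
      this into \<open>z \<ge> 75/22 * u\<close>, from where on the two bounds of
      \<open>no_window\<close> are compatible.\<close>
    have "47/50 * z - 3 * u \<ge> w - (z - ?x)"
      using signed_speed(2)[OF v x0 z(1) s] wj z(3) by simp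
    then show False using no_window[OF v sw s u i, of z] t z w u by simp
  qed
qed

text \<open>If the turn at \<open>- s * w\<close> is too near, a request further out in the same direction, released
  when the position is \<open>-3/50 * z\<close> at time \<open>z\<close>, forces a second turn.\<close>

lemma no_turn:
  assumes v: "valid_instance \<sigma>" and sw: "sweep c \<sigma> s u D" and s: "\<bar>s\<bar> = 1"
    and u: "0 < u" and i: "i < length \<sigma>" "dst (\<sigma> ! i) = s * u"
    and j: "j < length \<sigma>" "dst (\<sigma> ! j) = - s * w" "0 \<le> w"
    and t: "D \<le> del \<sigma> j" "u \<le> del \<sigma> j" "del \<sigma> j \<le> del \<sigma> i"
    and w: "3/50 * del \<sigma> j \<le> w" "3 * u \<le> del \<sigma> j + w"
  shows False
proof -
  let ?x = "del \<sigma> j" and ?y = "del \<sigma> i" and ?n = "length \<sigma>"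
  have ui: "s * loc \<sigma> ?y = u" by (rule loc_del[OF v i s])
  have wj: "s * loc \<sigma> ?x = - w" by (rule loc_del[OF v j(1) _ s]) (simp add: j)
  have x0: "0 \<le> ?x" using u t by simp
  obtain z where z: "?x \<le> z" "z \<le> ?y" "s * loc \<sigma> z = -3/50 * z + 0"
    using crossing[OF v x0 t(3), of s "-3/50" 0] ui wj w u t by auto
  have z3: "3 * u \<le> 53/50 * z"
    using signed_speed(2)[OF v x0 z(1) s] wj z(3) w by simp
  define \<sigma>' where "\<sigma>' = \<sigma> @ [point (s * (2 * u - z)) z]"
  have uz: "u \<le> z" "D \<le> z" using t z by auto
  note new = release_on_sweep[OF v sw s u uz, folded \<sigma>'_def]
  have len: "i < length \<sigma>'" "?n < length \<sigma>'" and dst: "dst (\<sigma>' ! i) = s * u"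
    "dst (\<sigma>' ! ?n) = - s * (z - 2 * u)"
    using i by (auto simp: \<sigma>'_def nth_append algebra_simps)
  have zi: "z \<le> del \<sigma>' i"
    unfolding \<sigma>'_def by (rule action_append(2)) (use new(1) i z in \<open>auto simp: \<sigma>'_def\<close>)
  have ui': "s * loc \<sigma>' (del \<sigma>' i) = u" by (rule loc_del[OF new(1) len(1) dst(1) s])
  have late: "del \<sigma>' i < 103/50 * z" "del \<sigma>' ?n < 103/50 * z"
    using deadline[OF new(1,2)] len u uz by auto
  \<comment> \<open>Starting at \<open>-3/50 * z\<close> at time \<open>z\<close>, serving
    \<open>s * u\<close> first takes at least until \<open>103/50 * z\<close>, the deadline.\<close>
  have le: "del \<sigma>' ?n \<le> del \<sigma>' i"
  proof (rule ccontr)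
    assume "\<not> ?thesis"
    then have "del \<sigma>' i \<le> del \<sigma>' ?n" by simp
    from signed_speed(1)[OF new(1) _ this s] signed_speed(2)[OF new(1) _ zi s] new(3-5) ui' late
      z(3) u uz zi show False by linarith
  qed
  \<comment> \<open>Together with \<open>late\<close> and \<open>z3\<close>, the first bound gives
    \<open>3/50 * del \<sigma>' ?n \<le> z - 2 * u\<close>, and the second one makes the new turn
    late enough for \<open>no_far_turn\<close>.\<close>
  have "u - (2 * u - z) \<le> del \<sigma>' i - del \<sigma>' ?n"
    using signed_speed(2)[OF new(1) _ le s] new(4,5) ui' u uz by linarith
  moreover have "-3/50 * z - (2 * u - z) \<le> del \<sigma>' ?n - z"
    using signed_speed(1)[OF new(1) _ new(4) s] new(3,5) z(3) u uz by linarith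
  ultimately show False
    using no_far_turn[OF new(1,2) s u len(1) dst(1) len(2) dst(2) _ new(4) _ le] late z3 new(4) uz u
    by (simp add: field_simps)
qed

text \<open>The bound on \<open>del \<sigma> j\<close> is \<open>103/50 * (2 * u + w) - 2 * (u + w)\<close>: serving \<open>s * u\<close> afterwards
  and then a further request at \<open>- s * w\<close> takes until \<open>103/50 * (2 * u + w)\<close>.\<close>

lemma no_critical:
  assumes v: "valid_instance \<sigma>" and sw: "sweep c \<sigma> s u (2 * u + w)" and s: "\<bar>s\<bar> = 1"
    and u: "0 < u" and i: "i < length \<sigma>" "dst (\<sigma> ! i) = s * u"
    and j: "j < length \<sigma>" "dst (\<sigma> ! j) = - s * w"
    and le: "del \<sigma> j \<le> del \<sigma> i"
    and w: "u \<le> 2 * w" and late: "53/25 * u + 3/50 * w \<le> del \<sigma> j"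
  shows False
proof -
  let ?x = "del \<sigma> j" and ?y = "del \<sigma> i" and ?n = "length \<sigma>" and ?t = "2 * u + w"
  have ui: "s * loc \<sigma> ?y = u" by (rule loc_del[OF v i s])
  have wj: "s * loc \<sigma> ?x = - w" by (rule loc_del[OF v j(1) _ s]) (simp add: j)
  have x0: "0 \<le> ?x" by (rule del_nonneg[OF v j(1)])
  have far: "u + w \<le> ?y - ?x" using signed_speed(2)[OF v x0 le s] ui wj by simp
  show False
  \<comment> \<open>If \<open>- s * w\<close> is served at \<open>?t\<close> or later,
    \<open>no_turn\<close> applies at once; otherwise a request there forces a return. In both cases
    \<open>u \<le> 2 * w\<close> gives \<open>3 * u \<le> ?t + w\<close>.\<close>
  proof (cases "?t \<le> ?x")
    case True
    have "?y < 103/50 * ?t" using deadline[OF v sw _ i(1)] u w by simp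
    then show False using no_turn[OF v sw s u i j _ True _ le] True far u w by simp
  next
    case False
    define \<sigma>' where "\<sigma>' = \<sigma> @ [point (s * (2 * u - ?t)) ?t]"
    have ut: "u \<le> ?t" "?t \<le> ?t" using u w by auto
    note new = release_on_sweep[OF v sw s u ut, folded \<sigma>'_def]
    have len: "i < length \<sigma>'" "j < length \<sigma>'" "?n < length \<sigma>'"
      and dst: "dst (\<sigma>' ! i) = s * u" "dst (\<sigma>' ! j) = - s * w" "dst (\<sigma>' ! ?n) = - s * w"
      using i j by (auto simp: \<sigma>'_def nth_append algebra_simps)
    have "?t \<le> ?y" using far late u w by linarith
    then have ti: "?t \<le> del \<sigma>' i"
      unfolding \<sigma>'_def by (intro action_append(2)) (use new(1) i in \<open>auto simp: \<sigma>'_def\<close>)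
    have xj: "del \<sigma>' j = ?x"
      unfolding \<sigma>'_def by (rule action_append(1)) (use new(1) j False in \<open>auto simp: \<sigma>'_def\<close>)
    have ui': "s * loc \<sigma>' (del \<sigma>' i) = u" by (rule loc_del[OF new(1) len(1) dst(1) s])
    have wj': "s * loc \<sigma>' ?x = - w"
      using loc_del[OF new(1) len(2), of s "- w"] dst(2) s xj by simp
    have on_time: "del \<sigma>' i < 103/50 * ?t" "del \<sigma>' ?n < 103/50 * ?t"
      using deadline[OF new(1,2)] len u w by auto
    have xi: "?x \<le> del \<sigma>' i" using ti False by simp
    have le': "del \<sigma>' ?n \<le> del \<sigma>' i"
    proof (rule ccontr)
      assume "\<not> ?thesis"
      then have order: "del \<sigma>' i \<le> del \<sigma>' ?n" by simp
      have "u + w \<le> del \<sigma>' ?n - del \<sigma>' i"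
        using signed_speed(1)[OF new(1) _ order s] new(5) ui' x0 xi by simp
      moreover have "u + w \<le> del \<sigma>' i - ?x"
        using signed_speed(2)[OF new(1) x0 xi s] ui' wj' by simp
      ultimately show False using on_time(2) late by argo
    qed
    have "u + w \<le> del \<sigma>' i - del \<sigma>' ?n"
      using signed_speed(2)[OF new(1) _ le' s] new(4,5) ui' u w by simp
    then show False
      using no_turn[OF new(1,2) s u len(1) dst(1) len(3) dst(3) _ new(4) _ le'] on_time new(4) u w
      by simp
  qed
qed

section \<open>The rides and the full vehicle\<close>

definition rides :: "real \<Rightarrow> request list" where
  "rides s = replicate c \<lparr>src = s, dst = s * (3/2), rel = 1\<rparr>"

lemma length_rides [simp]: "length (rides s) = c"
  by (simp add: rides_def)

lemma nth_rides [simp]: "i < c \<Longrightarrow> rides s ! i = \<lparr>src = s, dst = s * (3/2), rel = 1\<rparr>"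
  by (simp add: rides_def)

lemma valid_rides [simp]: "valid_instance (rides s)"
  by (simp add: valid_instance_def rides_def)

lemma ride_served:
  assumes "valid_instance (rides s @ qs)" "i < c" "\<bar>s\<bar> = 1"
  shows "1 \<le> pickup (Alg (rides s @ qs)) i"
    "pickup (Alg (rides s @ qs)) i + 1/2 \<le> del (rides s @ qs) i"
    "s * loc (rides s @ qs) (pickup (Alg (rides s @ qs)) i) = 1"
    "s * loc (rides s @ qs) (del (rides s @ qs) i) = 3/2"
proof -
  have i: "i < length (rides s @ qs)" using assms(2) by simp
  have nth: "(rides s @ qs) ! i = \<lparr>src = s, dst = s * (3/2), rel = 1\<rparr>"
    using assms(2) by (simp add: nth_append)
  have "s * s = 1" using assms(3) abs_mult_self_eq[of s] by simp
  note A = Alg_serves[OF assms(1) i, unfolded nth, simplified]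
  show 1: "1 \<le> pickup (Alg (rides s @ qs)) i" by (rule A)
  show 2: "s * loc (rides s @ qs) (pickup (Alg (rides s @ qs)) i) = 1"
    using A(4) \<open>s * s = 1\<close> by simp
  show 3: "s * loc (rides s @ qs) (del (rides s @ qs) i) = 3/2"
    by (rule loc_del[OF assms(1) i _ assms(3)]) (simp add: nth)
  show "pickup (Alg (rides s @ qs)) i + 1/2 \<le> del (rides s @ qs) i"
    using signed_speed(2)[OF assms(1) _ A(2) assms(3)] 1 2 3 by simp
qed

text \<open>While the first \<open>c\<close> requests are all aboard, there is no place for
  \<open>j\<close>. If \<open>j\<close> is loaded and unloaded at one instant, this is the second
  clause of \<open>respects_capacity\<close>, otherwise the first.\<close>

lemma full_vehicle:
  assumes v: "valid_instance \<sigma>" and len: "c \<le> j" "j < length \<sigma>"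
    and t: "\<And>i. i < c \<Longrightarrow> pickup (Alg \<sigma>) i \<le> t" "t < del \<sigma> j"
  shows "\<exists>i<c. del \<sigma> i \<le> del \<sigma> j"
proof (rule ccontr)
  assume "\<not> ?thesis"
  then have undelivered: "del \<sigma> j < del \<sigma> i" if "i < c" for i
    using that by (simp add: not_le)
  have cap: "card (carried (length \<sigma>) (Alg \<sigma>) x) \<le> c"
    "pickup (Alg \<sigma>) j = del \<sigma> j \<Longrightarrow> card (carried_through (length \<sigma>) (Alg \<sigma>) (pickup (Alg \<sigma>) j)) < c" for x
    using Alg_feasible[OF v] len by (auto simp: feasible_def respects_capacity_def)
  show False
  proof (cases "pickup (Alg \<sigma>) j = del \<sigma> j")
    case True
    have "{..<c} \<subseteq> carried_through (length \<sigma>) (Alg \<sigma>) (pickup (Alg \<sigma>) j)"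
    proof
      fix i assume "i \<in> {..<c}"
      then show "i \<in> carried_through (length \<sigma>) (Alg \<sigma>) (pickup (Alg \<sigma>) j)"
        using undelivered[of i] t(1)[of i] t(2) len True by (simp add: carried_through_def)
    qed
    moreover have "finite (carried_through (length \<sigma>) (Alg \<sigma>) (pickup (Alg \<sigma>) j))"
      by (simp add: carried_through_def)
    ultimately have "card {..<c} \<le> card (carried_through (length \<sigma>) (Alg \<sigma>) (pickup (Alg \<sigma>) j))"
      by (metis card_mono)
    then show False using cap(2)[OF True] by simp
  next
    case False
    let ?x = "max (pickup (Alg \<sigma>) j) t"
    have "?x < del \<sigma> j" using False Alg_serves(2)[OF v len(2)] t(2) by simp
    have "insert j {..<c} \<subseteq> carried (length \<sigma>) (Alg \<sigma>) ?x"
    proof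
      fix i assume "i \<in> insert j {..<c}"
      then show "i \<in> carried (length \<sigma>) (Alg \<sigma>) ?x"
        using undelivered[of i] t(1)[of i] len \<open>?x < del \<sigma> j\<close>
        by (cases "i = j") (auto simp: carried_def)
    qed
    moreover have "finite (carried (length \<sigma>) (Alg \<sigma>) ?x)"
      by (simp add: carried_def)
    ultimately have "card (insert j {..<c}) \<le> card (carried (length \<sigma>) (Alg \<sigma>) ?x)"
      by (metis card_mono)
    then show False using cap(1)[of ?x] len by simp
  qed
qed

section \<open>The adversary's strategy\<close>

text \<open>When the last ride \<open>m\<close> is loaded, the vehicle is full. A request at
  \<open>s * r\<close> is then placed such that \<open>no_critical\<close> applies to either order
  of serving it and \<open>- s * t\<close>.\<close>

lemma no_loaded_turn:
  assumes s: "\<bar>s\<bar> = 1" and t: "3/2 \<le> t" "t \<le> 13/8"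
  defines "\<sigma> \<equiv> rides s @ [point (- s * t) t]"
  assumes m: "m < c" "\<And>i. i < c \<Longrightarrow> pickup (Alg \<sigma>) i \<le> pickup (Alg \<sigma>) m"
    "\<And>i. i < c \<Longrightarrow> pickup (Alg \<sigma>) m + 1/2 \<le> del \<sigma> i"
    and early: "t + 1/2 \<le> pickup (Alg \<sigma>) m" "pickup (Alg \<sigma>) m < 53/25 * t - 41/100"
    and last: "\<And>i. i < c \<Longrightarrow> del \<sigma> i \<le> del \<sigma> c"
  shows False
proof -
  define t1 where "t1 = pickup (Alg \<sigma>) m"
  \<comment> \<open>The release comes after the last loading, but before any delivery:
    \<open>r \<le> t1 + 1/2\<close> because \<open>2 \<le> t1\<close>. The value 5/2 puts
    \<open>s * r\<close> far enough away for the case that it is served first.\<close>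
  define r where "r = max (t1 + 1/20) (5/2)"
  have r: "t1 + 1/20 \<le> r" "5/2 \<le> r" "r \<le> t1 + 1/2" "t \<le> r" "r \<le> 2 * t"
    "r = t1 + 1/20 \<or> r = 5/2"
    using early t by (auto simp: r_def t1_def)
  define \<sigma>' where "\<sigma>' = \<sigma> @ [point (s * r) r]"
  have \<sigma>': "\<sigma>' = rides s @ [point (- s * t) t, point (s * r) r]" by (simp add: \<sigma>'_def \<sigma>_def)
  have v': "valid_instance \<sigma>'"
    using t r valid_rides[of s] by (auto simp: valid_instance_def \<sigma>')
  have len: "c < length \<sigma>'" "Suc c < length \<sigma>'" "m < length \<sigma>'"
    and dst: "dst (\<sigma>' ! c) = - s * t" "dst (\<sigma>' ! Suc c) = s * r"
    using m by (auto simp: \<sigma>' nth_append)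
  have lenc: "i < length \<sigma>" if "i < c" for i using that by (simp add: \<sigma>_def)
  have rel: "\<forall>q\<in>set [point (s * r) r]. r \<le> rel q" by simp
  note keep = action_append[OF v'[unfolded \<sigma>'_def] rel, folded \<sigma>'_def]
  have pick: "pickup (Alg \<sigma>') i = pickup (Alg \<sigma>) i" if "i < c" for i
    using keep(3)[OF lenc[OF that]] m(2)[OF that] r(1) by (simp add: t1_def)
  have held: "r \<le> del \<sigma>' i" if "i < c" for i
    using keep(2)[OF lenc[OF that]] m(3)[OF that] r(3) by (simp add: t1_def)
  have "r \<le> del \<sigma> c" using last[OF m(1)] m(3)[OF m(1)] r(3) by (simp add: t1_def)
  then have Lr: "r \<le> del \<sigma>' c" by (intro keep(2)) (simp_all add: \<sigma>_def)
  have Rr: "r \<le> del \<sigma>' (Suc c)"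
    using Alg_serves(1,2)[OF v' len(2)] by (simp add: \<sigma>' nth_append)
  note served = ride_served[of s "[point (- s * t) t, point (s * r) r]", folded \<sigma>', OF v' _ s]
  have at1: "s * loc \<sigma>' t1 = 1" using served(3)[OF m(1)] pick[OF m(1)] by (simp add: t1_def)
  have t1: "0 \<le> t1" using early t by (simp add: t1_def)
  have L: "s * loc \<sigma>' (del \<sigma>' c) = - t" using dst(1) by (intro loc_del[OF v' len(1) _ s]) simp
  have R: "s * loc \<sigma>' (del \<sigma>' (Suc c)) = r" by (rule loc_del[OF v' len(2) dst(2) s])
  have R_late: "t1 + r - 1 \<le> del \<sigma>' (Suc c)"
    using signed_speed(2)[OF v' t1 _ s, of "del \<sigma>' (Suc c)"] at1 R Rr r by simp
  \<comment> \<open>The full vehicle goes from \<open>s\<close> to \<open>s * (3/2)\<close> before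
    it serves \<open>- s * t\<close>.\<close>
  have L_late: "t1 + 2 + t \<le> del \<sigma>' c"
  proof -
    have "pickup (Alg \<sigma>') i \<le> t1" if "i < c" for i
      using m(2)[OF that] pick[OF that] by (simp add: t1_def)
    moreover have "t1 < del \<sigma>' c" using Lr r by simp
    ultimately obtain i where i: "i < c" "del \<sigma>' i \<le> del \<sigma>' c"
      using full_vehicle[OF v' order.refl len(1)] by blast
    have "t1 \<le> del \<sigma>' i" using held[OF i(1)] r by simp
    from signed_speed(2)[OF v' t1 this s] signed_speed(1)[OF v' _ i(2) s] at1 L served(4)[OF i(1)]
      t1 this show ?thesis by simp
  qed
  have RL: "sweep c \<sigma>' s r (2 * r + t)"
    unfolding \<sigma>' rides_def using c_pos s t r
    by (intro sweep_rides[where x = 1 and y = "3/2" and g = "\<lambda>j. if j = 0 then 2 * r + t else r"])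
      (auto simp: less_Suc_eq algebra_simps)
  have LR: "sweep c \<sigma>' (- s) t (2 * t + r)"
    unfolding \<sigma>' rides_def using c_pos s t r
    by (intro sweep_rides[where x = "2 * t + 1" and y = "2 * t + 3/2"
          and g = "\<lambda>j. if j = 0 then t else 2 * t + r"])
      (auto simp: less_Suc_eq algebra_simps)
  have s': "\<bar>- s\<bar> = 1" using s by simp
  show False
  proof (cases "del \<sigma>' (Suc c) \<le> del \<sigma>' c")
    case True
    have "53/25 * t + 3/50 * r \<le> del \<sigma>' (Suc c)"
      using R_late early[folded t1_def] r(1-5) t by linarith
    then show False
      using no_critical[OF v' LR s' _ len(1) dst(1) len(2) _ True] dst(2) t r by simp
  next
    case False
    have "53/25 * r + 3/50 * t \<le> del \<sigma>' c"
      using r(6) L_late early[folded t1_def] r(1-5) t by (elim disjE) linarith+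
    then show False
      using no_critical[OF v' RL s _ len(2) dst(2) len(1) dst(1)] False t r by simp
  qed
qed

text \<open>The lower bound in \<open>p\<close> says that going straight to \<open>- s * t\<close>
  takes until \<open>53/25 * (3/2) + 3/50 * t\<close> or later, as \<open>no_critical\<close>
  requires. The upper bound delays every loading to \<open>t + 1/2\<close>.\<close>

lemma no_second_request:
  assumes s: "\<bar>s\<bar> = 1" and start: "s * loc (rides s) 1 \<le> 0" and t: "3/2 \<le> t" "t \<le> 13/8"
    and p: "159/50 - 97/50 * t \<le> s * loc (rides s) t" "s * loc (rides s) t \<le> 1/2"
  shows False
proof -
  define \<sigma> where "\<sigma> = rides s @ [point (- s * t) t]"
  have v: "valid_instance \<sigma>"
    using t valid_rides[of s] by (auto simp: valid_instance_def \<sigma>_def)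
  have len: "c < length \<sigma>" and lenc: "\<And>i. i < c \<Longrightarrow> i < length \<sigma>" and dst: "dst (\<sigma> ! c) = - s * t"
    "\<And>i. i < c \<Longrightarrow> dst (\<sigma> ! i) = s * (3/2)"
    by (auto simp: \<sigma>_def nth_append)
  have same: "loc \<sigma> x = loc (rides s) x" if "0 \<le> x" "x \<le> t" for x
    unfolding \<sigma>_def by (rule loc_append[of _ _ t]) (use v that in \<open>auto simp: \<sigma>_def\<close>)
  have at1: "s * loc \<sigma> 1 \<le> 0" and att: "s * loc \<sigma> t = s * loc (rides s) t"
    using same[of 1] same[of t] start t by auto
  note served = ride_served[of s "[point (- s * t) t]", folded \<sigma>_def, OF v _ s]
  have pick: "t + 1/2 \<le> pickup (Alg \<sigma>) i" "t + 1 - s * loc \<sigma> t \<le> pickup (Alg \<sigma>) i" if i: "i < c" for i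
  proof -
    have "2 \<le> pickup (Alg \<sigma>) i"
      using signed_speed(2)[OF v _ served(1)[OF i] s] served(3)[OF i] at1 by simp
    then have "t \<le> pickup (Alg \<sigma>) i" using t by simp
    from signed_speed(2)[OF v _ this s] served(3)[OF i] t
    show "t + 1 - s * loc \<sigma> t \<le> pickup (Alg \<sigma>) i" by simp
    then show "t + 1/2 \<le> pickup (Alg \<sigma>) i" using att p by simp
  qed
  have Lt: "t \<le> del \<sigma> c"
    using Alg_serves(1,2)[OF v len] by (simp add: \<sigma>_def nth_append)
  have L: "s * loc \<sigma> (del \<sigma> c) = - t" using dst(1) by (intro loc_del[OF v len _ s]) simp
  have L_late: "2 * t + s * loc \<sigma> t \<le> del \<sigma> c"
    using signed_speed(1)[OF v _ Lt s] L t by simp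
  have RL: "sweep c \<sigma> s (3/2) (2 * (3/2) + t)"
    unfolding \<sigma>_def rides_def using c_pos s t
    by (intro sweep_rides[where x = 1 and y = "3/2" and g = "\<lambda>j. 3 + t"]) (auto simp: algebra_simps)
  have LR: "sweep c \<sigma> (- s) t (2 * t + 3/2)"
    unfolding \<sigma>_def rides_def using c_pos s t
    by (intro sweep_rides[where x = "2 * t + 1" and y = "2 * t + 3/2" and g = "\<lambda>j. t"])
      (auto simp: algebra_simps)
  have s': "\<bar>- s\<bar> = 1" using s by simp
  have last: "del \<sigma> i \<le> del \<sigma> c" if i: "i < c" for i
  proof (rule ccontr)
    assume "\<not> ?thesis"
    then have "del \<sigma> c \<le> del \<sigma> i" by simp
    from no_critical[OF v RL s _ lenc[OF i] dst(2)[OF i] len dst(1) this] L_late att p t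
    show False by simp
  qed
  \<comment> \<open>This is the bound of \<open>no_critical\<close> for the tour that serves
    \<open>- s * t\<close> first, with \<open>u = t\<close> and \<open>w = 3/2\<close>.\<close>
  have early: "del \<sigma> i < 53/25 * t + 9/100" if i: "i < c" for i
  proof (rule ccontr)
    assume "\<not> ?thesis"
    then have "53/25 * t + 3/50 * (3/2) \<le> del \<sigma> i" by simp
    from no_critical[OF v LR s' _ len dst(1) lenc[OF i] _ last[OF i] _ this] dst(2)[OF i] t
    show False by simp
  qed
  have "pickup (Alg \<sigma>) ` {..<c} \<noteq> {}" "finite (pickup (Alg \<sigma>) ` {..<c})" using c_pos by auto
  from Max_in[OF this(2,1)] obtain m where "m < c"
    "pickup (Alg \<sigma>) m = Max (pickup (Alg \<sigma>) ` {..<c})" by auto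
  then have m: "m < c" "\<And>i. i < c \<Longrightarrow> pickup (Alg \<sigma>) i \<le> pickup (Alg \<sigma>) m" by simp_all
  \<comment> \<open>If a ride were delivered before the last loading, the server would go from
    \<open>s\<close> to \<open>s * (3/2)\<close>, back, and there again, contradicting
    \<open>early\<close> for \<open>m\<close>.\<close>
  have "pickup (Alg \<sigma>) m + 1/2 \<le> del \<sigma> i" if i: "i < c" for i
  proof (cases "del \<sigma> i \<le> pickup (Alg \<sigma>) m")
    case True
    have "0 \<le> del \<sigma> i" by (rule del_nonneg[OF v lenc[OF i]])
    from signed_speed(1)[OF v this True s] served(3)[OF m(1)] served(4)[OF i]
    have "1/2 \<le> pickup (Alg \<sigma>) m - del \<sigma> i" by simp
    then show ?thesis
      using served(2)[OF i] served(2)[OF m(1)] pick(2)[OF i] early[OF m(1)] p att t by linarith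
  next
    case False
    then show ?thesis
      using signed_speed(2)[OF v _ _ s, of "pickup (Alg \<sigma>) m" "del \<sigma> i"] served(1,3)[OF m(1)]
        served(4)[OF i] by simp
  qed
  moreover have "pickup (Alg \<sigma>) m < 53/25 * t - 41/100" using early[OF m(1)] served(2)[OF m(1)] by simp
  ultimately show False
    using no_loaded_turn[OF s t m(1)] m(2) pick(1)[OF m(1)] last unfolding \<sigma>_def by blast
qed

lemma no_fast_algorithm: False
proof -
  define s :: real where "s = (if loc [] 1 \<le> 0 then 1 else -1)"
  have s: "\<bar>s\<bar> = 1" "s * loc [] 1 \<le> 0" by (auto simp: s_def)
  let ?p = "\<lambda>t. s * loc (rides s) t"
  have start: "?p 1 \<le> 0"
    using loc_append[of "[]" "rides s" 1 1] s by (simp add: rides_def valid_instance_def)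
  have "sweep c (rides s @ []) s (3/2) (3/2)"
    unfolding rides_def using c_pos s(1)
    by (intro sweep_rides[where x = 1 and y = "3/2" and g = "\<lambda>j. 0"]) (auto simp: algebra_simps)
  then have due: "del (rides s) 0 < 309/100"
    using deadline[of "rides s @ []" s "3/2" "3/2" 0] c_pos by simp
  note served = ride_served[of s "[]" 0, simplified, OF c_pos s(1)]
  have two: "2 \<le> pickup (Alg (rides s)) 0"
    using signed_speed(2)[OF valid_rides[of s] _ served(1) s(1)] served(3) start by simp
  have p1: "?p (3/2) \<le> 1/2"
    using signed_speed(2)[OF valid_rides, of 1 "3/2" s s] s start by simp
  have p2: "?p (13/8) \<le> ?p (3/2) + 1/8"
    using signed_speed(2)[OF valid_rides, of "3/2" "13/8" s s] s by simp
  \<comment> \<open>A ride is loaded at \<open>s\<close> before time \<open>309/100 - 1/2\<close>,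
    so the server cannot be far from \<open>s\<close> at time 13/8.\<close>
  have p3: "7/200 \<le> ?p (13/8)"
    using signed_speed(2)[OF valid_rides, of "13/8" "pickup (Alg (rides s)) 0" s s] s two due served(2,3)
    by simp
  show False
  \<comment> \<open>The lower bound of \<open>no_second_request\<close> is 27/100 for
    \<open>t = 3/2\<close> and only 11/400 for \<open>t = 13/8\<close>.\<close>
  proof (cases "27/100 \<le> ?p (3/2)")
    case True
    then show False using no_second_request[OF s(1) start, of "3/2"] p1 by simp
  next
    case False
    then show False using no_second_request[OF s(1) start, of "13/8"] p2 p3 by simp
  qed
qed

end

theorem theorem1p1:
  fixes c :: nat and \<epsilon> :: real
  assumes "\<epsilon> > 0"
  shows "\<not> (\<exists>Alg. online_algorithm c Alg \<and> competitive c (rho - \<epsilon>) Alg)"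
proof
  assume "\<exists>Alg. online_algorithm c Alg \<and> competitive c (rho - \<epsilon>) Alg"
  then obtain Alg where online: "online_algorithm c Alg" and comp: "competitive c (rho - \<epsilon>) Alg"
    by blast
  \<comment> \<open>With capacity 0 a single request has no feasible schedule, so no online
    algorithm exists.\<close>
  have "0 < c"
  proof (rule ccontr)
    assume "\<not> 0 < c"
    then have c: "c = 0" by simp
    have "valid_instance [point 0 0]" by (simp add: valid_instance_def)
    then have "feasible 0 [point 0 0] (Alg [point 0 0])"
      using online c by (simp add: online_algorithm_def)
    then obtain S where S: "feasible 0 [point 0 0] S" by blast
    have "card (carried 1 S (pickup S 0)) = 0" "pickup S 0 \<noteq> delivery S 0" "pickup S 0 \<le> delivery S 0"
      using S by (auto simp: feasible_def respects_capacity_def)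
    moreover have "finite (carried 1 S (pickup S 0))" by (simp add: carried_def)
    ultimately show False by (auto simp: carried_def)
  qed
  have "fast_algorithm c Alg"
  proof
    fix \<sigma> S D i
    assume v: "valid_instance \<sigma>" and S: "feasible c \<sigma> S" "completion_time \<sigma> S \<le> D"
      and D: "0 < D" and i: "i < length \<sigma>"
    let ?C = "{completion_time \<sigma> S | S. feasible c \<sigma> S}"
    have nonneg: "0 \<le> x" if "x \<in> ?C" for x using that by (auto simp: completion_time_def)
    have "bdd_below ?C" using nonneg by (rule bdd_belowI)
    then have "Opt c \<sigma> \<le> completion_time \<sigma> S"
      unfolding Opt_def by (rule cInf_lower[rotated]) (use S in blast)
    moreover have "0 \<le> Opt c \<sigma>"
      unfolding Opt_def by (rule cInf_greatest) (use S nonneg in auto)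
    ultimately have O: "0 \<le> Opt c \<sigma>" "Opt c \<sigma> \<le> D" using S by auto
    have "delivery (Alg \<sigma>) i \<le> completion_time \<sigma> (Alg \<sigma>)"
      using i by (auto simp: completion_time_def)
    also have "\<dots> \<le> (rho - \<epsilon>) * Opt c \<sigma>" using comp v by (simp add: competitive_def)
    \<comment> \<open>The gap between 2.0585 and 103/50 makes the final bound strict.\<close>
    also have "\<dots> \<le> 20585/10000 * Opt c \<sigma>"
      using O(1) rho_bounds(2) assms by (intro mult_right_mono) auto
    finally show "delivery (Alg \<sigma>) i < 103/50 * D" using O D by simp
  qed (use \<open>0 < c\<close> online in auto)
  then show False by (rule fast_algorithm.no_fast_algorithm)
qed

end
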